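(* Let $f\colon\mathbb{R}^n\to\mathbb{R}^n$, $g\colon\mathbb{R}^n\to\mathbb{R}^{n,m}$, $h\colon\mathbb{R}^n\to\mathbb{R}^m$ be continuous with $f(0)=0$. Assume that there are $\mathcal{H}\in C^1(\mathbb{R}^n,\mathbb{R}_{\ge0})$ and $\ell\in C^0(\mathbb{R}^n,\mathbb{R}^p)$ with $$\nabla\mathcal{H}(z)^{\mathsf T}f(z)=-\ell(z)^{\mathsf T}\ell(z),\qquad g(z)^{\mathsf T}\nabla\mathcal{H}(z)=h(z)\qquad\text{for all }z\in\mathbb{R}^n,$$ where $\mathcal{H}$ is radially unbounded, $\mathcal{H}(0)=0$ and $\mathcal{H}(z)>0$ for $z\ne0$. Additionally, let $\ell(z)^{\mathsf T}\ell(z)+h(z)^{\mathsf T}h(z)>0$ for $z\neq0$. Then $\mathcal{H}$ is the value function of the optimal control problem $$\inf_{u\in\tilde{\mathcal{U}}_{\mathrm{ad}}(z_0)}\left\{\frac12\int_0^\infty h(z)^{\mathsf T}h(z)+2\ell(z)^{\mathsf T}\ell(z)+u^{\mathsf T}u\,\mathrm{d}t\right\}$$ subject to $\dot z=f(z)+g(z)u$, $z(0)=z_0$, where $\tilde{\mathcal{U}}_{\mathrm{ad}}(z_0)$ is the set of all $u\in L^2([0,\infty),\mathbb{R}^m)$ that render this integral finite and satisfy $\lim_{t\to\infty}z(t;u)=0$; and the feedback law $\tilde u^*(z)=-g(z)^{\mathsf T}\nabla\mathcal{H}(z)=-h(z)$ is an optimal control.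
   Context: The plant is $\dot z=f(z)+g(z)u$, $z(0)=z_0$, $y=h(z)$ with state $z(t)\in\mathbb{R}^n$ and input $u(t)\in\mathbb{R}^m$; standing assumption: solutions exist on $[0,\infty)$ in the sense of Carathéodory. $z(t;u)$ denotes the trajectory at time $t$ associated with the control $u$. The value function of the optimal control problem is the function assigning to $z_0$ the infimum. A function $\phi\colon\mathbb{R}^n\to\mathbb{R}$ is radially unbounded if $\|z\|\to\infty$ implies $\phi(z)\to\infty$. *)

theory Defs
  imports "HOL-Analysis.Analysis"
begin

definition gradient :: "('a::euclidean_space \<Rightarrow> real) \<Rightarrow> 'a \<Rightarrow> 'a" where
  "gradient F x = (THE D. GDERIV F x :> D)"

lemma gradient_eqI:
  assumes "GDERIV F x :> D"
  shows "gradient F x = D"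
  unfolding gradient_def
proof (rule the_equality)
  show "GDERIV F x :> D" by (fact assms)
next
  fix D' assume "GDERIV F x :> D'"
  with assms have "(\<lambda>v. inner v D') = (\<lambda>v. inner v D)"
    unfolding gderiv_def by (rule has_derivative_unique[rotated])
  then show "D' = D"
    by (metis vector_eq_ldot)
qed

lemma gderiv_gradient:
  assumes "F differentiable (at x)"
  shows "GDERIV F x :> gradient F x"
proof -
  obtain F' where F': "(F has_derivative F') (at x)"
    using assms unfolding differentiable_def by blast
  then have lin: "linear F'"
    by (rule has_derivative_linear)
  have "inner v (adjoint F' 1) = F' v" for v
    using adjoint_works[OF lin, of v 1] by simp
  with F' have "GDERIV F x :> adjoint F' 1"
    by (simp add: gderiv_def)
  then show ?thesis
    by (simp add: gradient_eqI)
qed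

definition C1 :: "('a::euclidean_space \<Rightarrow> real) \<Rightarrow> bool" where
  "C1 F \<longleftrightarrow> (\<forall>x. F differentiable (at x)) \<and> continuous_on UNIV (gradient F)"

text \<open>
  Absolute continuity of a function of one real variable in the usual epsilon-delta sense.  A
  division is a finite family of non-overlapping nonempty compact intervals, and the intervals
  \<open>k\<close> are \<open>{Inf k..Sup k}\<close>.  (The library constant \<open>absolutely_continuous\<close> is about measures.)
\<close>

definition abs_cont_on :: "real set \<Rightarrow> (real \<Rightarrow> 'a::real_normed_vector) \<Rightarrow> bool" where
  "abs_cont_on S z \<longleftrightarrow>
     (\<forall>\<epsilon>>0. \<exists>\<delta>>0. \<forall>\<D> A. \<D> division_of A \<and> A \<subseteq> S \<and> (\<Sum>k\<in>\<D>. Sup k - Inf k) < \<delta> \<longrightarrow>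
        (\<Sum>k\<in>\<D>. norm (z (Sup k) - z (Inf k))) < \<epsilon>)"

text \<open>
  Trajectories and controls are total functions on the reals; only their values on
  \<open>[0,\<infinity>)\<close> matter.  A trajectory is a Caratheodory solution on all of \<open>[0,\<infinity>)\<close>.  Since \<open>f\<close> and \<open>g\<close>
  are merely continuous, a control need not determine it uniquely, so it is a relation between
  the control and the state.
\<close>

definition trajectory ::
  "(real^'n \<Rightarrow> real^'n) \<Rightarrow> (real^'n \<Rightarrow> real^'m^'n) \<Rightarrow> real^'n \<Rightarrow> (real \<Rightarrow> real^'m) \<Rightarrow>
   (real \<Rightarrow> real^'n) \<Rightarrow> bool" where
  "trajectory f g z0 u z \<longleftrightarrow>
     z 0 = z0 \<and> (\<forall>T\<ge>0. abs_cont_on {0..T} z) \<and>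
     (AE t in lebesgue_on {0..}.
        (z has_vector_derivative (f (z t) + g (z t) *v u t)) (at t within {0..}))"

definition L2_control :: "(real \<Rightarrow> real^'m) \<Rightarrow> bool" where
  "L2_control u \<longleftrightarrow> u \<in> borel_measurable (lebesgue_on {0..}) \<and>
     integrable (lebesgue_on {0..}) (\<lambda>t. (norm (u t))\<^sup>2)"

definition solutions_exist :: "(real^'n \<Rightarrow> real^'n) \<Rightarrow> (real^'n \<Rightarrow> real^'m^'n) \<Rightarrow> bool" where
  "solutions_exist f g \<longleftrightarrow> (\<forall>z0 u. L2_control u \<longrightarrow> (\<exists>z. trajectory f g z0 u z))"

text \<open>The integrand is nonnegative, so the cost is taken in \<open>[0,\<infinity>]\<close>.\<close>

definition cost ::
  "(real^'n \<Rightarrow> real^'m) \<Rightarrow> (real^'n \<Rightarrow> real^'p) \<Rightarrow> (real \<Rightarrow> real^'n) \<Rightarrow> (real \<Rightarrow> real^'m) \<Rightarrow> ennreal"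
where
  "cost h l z u =
     ennreal (1/2) * (\<integral>\<^sup>+ t. ennreal (h (z t) \<bullet> h (z t) + 2 * (l (z t) \<bullet> l (z t)) + u t \<bullet> u t)
                        \<partial>lebesgue_on {0..})"

text \<open>
  Admissible controls, paired with an associated trajectory; if trajectories are unique, the
  pairs correspond to the admissible controls.
\<close>

definition admissible ::
  "(real^'n \<Rightarrow> real^'n) \<Rightarrow> (real^'n \<Rightarrow> real^'m^'n) \<Rightarrow> (real^'n \<Rightarrow> real^'m) \<Rightarrow> (real^'n \<Rightarrow> real^'p) \<Rightarrow>
   real^'n \<Rightarrow> ((real \<Rightarrow> real^'n) \<times> (real \<Rightarrow> real^'m)) set" where
  "admissible f g h l z0 =
     {(z, u). L2_control u \<and> trajectory f g z0 u z \<and> cost h l z u < \<infinity> \<and> (z \<longlongrightarrow> 0) at_top}"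

definition value_function ::
  "(real^'n \<Rightarrow> real^'n) \<Rightarrow> (real^'n \<Rightarrow> real^'m^'n) \<Rightarrow> (real^'n \<Rightarrow> real^'m) \<Rightarrow> (real^'n \<Rightarrow> real^'p) \<Rightarrow>
   real^'n \<Rightarrow> ennreal" where
  "value_function f g h l z0 = (INF (z, u) \<in> admissible f g h l z0. cost h l z u)"

text \<open>
  The closed loop under the feedback \<open>\<kappa>\<close> has a solution for every initial value, and each such
  solution yields an admissible control attaining the infimum.
\<close>

definition optimal_feedback ::
  "(real^'n \<Rightarrow> real^'n) \<Rightarrow> (real^'n \<Rightarrow> real^'m^'n) \<Rightarrow> (real^'n \<Rightarrow> real^'m) \<Rightarrow> (real^'n \<Rightarrow> real^'p) \<Rightarrow>
   (real^'n \<Rightarrow> real^'m) \<Rightarrow> bool" where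
  "optimal_feedback f g h l \<kappa> \<longleftrightarrow>
     (\<forall>z0. (\<exists>z. trajectory f g z0 (\<lambda>t. \<kappa> (z t)) z) \<and>
       (\<forall>z. trajectory f g z0 (\<lambda>t. \<kappa> (z t)) z \<longrightarrow>
          (z, \<lambda>t. \<kappa> (z t)) \<in> admissible f g h l z0 \<and>
          cost h l z (\<lambda>t. \<kappa> (z t)) = value_function f g h l z0))"

end

(* Along a trajectory, d/dt H(z) = h(z) . u - |l(z)|^2, so the running cost h.h + 2 l.l + u.u equals
   |u + h(z)|^2 - 2 d/dt H(z).  As H(z(t)) tends to 0 for admissible controls, the cost is at least
   H(z0), with equality exactly for u = -h(z).  The closed loop under u = -h(z) is solvable by Peano's
   theorem, because H decreases along it and has compact sublevel sets.  It tends to 0: otherwise it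
   would stay in a compact set on which H decreases at a rate bounded away from 0. *)

theory Submission
  imports Defs "HOL-Complex_Analysis.Great_Picard"
begin

text \<open>Weak regularity shapes the analysis. A trajectory satisfies its equation only almost
  everywhere, so \<open>H (z t)\<close> need not be differentiable at every time. Absolute
  continuity passes from \<open>z\<close> to \<open>H (z t)\<close>, and a fundamental theorem for
  absolutely continuous functions, in terms of the gauge integral, then yields integrability of the
  derivative together with the energy balance. Under the feedback, the plant becomes an autonomous
  equation with a merely continuous right-hand side. Its solutions may fail to be unique, so
  stability and optimality are shown for an arbitrary closed-loop solution, and existence is
  obtained from approximations with a time delay. The balance holds on finite horizons, whereas the
  cost is an extended nonnegative Lebesgue integral over the half line. The lower bound passes to
  the limit through \<open>H (z T)\<close> tending to 0; the upper bound for the feedback follows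
  from \<open>H\<close> being nonnegative and monotone convergence.\<close>

section \<open>Absolutely continuous functions\<close>

lemma abs_cont_onD:
  assumes "abs_cont_on S z" "\<epsilon> > 0"
  obtains \<delta> where "\<delta> > 0"
    "\<And>\<D> A. \<lbrakk>\<D> division_of A; A \<subseteq> S; (\<Sum>k\<in>\<D>. Sup k - Inf k) < \<delta>\<rbrakk>
       \<Longrightarrow> (\<Sum>k\<in>\<D>. norm (z (Sup k) - z (Inf k))) < \<epsilon>"
  using assms unfolding abs_cont_on_def by meson

lemma abs_cont_on_imp_continuous_on:
  assumes z: "abs_cont_on {a..b} z"
  shows "continuous_on {a..b} z"
  unfolding continuous_on_iff
proof (intro ballI allI impI)
  fix x e :: real assume x: "x \<in> {a..b}" and e: "0 < e"
  obtain d where d: "d > 0"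
    "\<And>\<D> A. \<lbrakk>\<D> division_of A; A \<subseteq> {a..b}; (\<Sum>k\<in>\<D>. Sup k - Inf k) < d\<rbrakk>
       \<Longrightarrow> (\<Sum>k\<in>\<D>. norm (z (Sup k) - z (Inf k))) < e"
    using abs_cont_onD[OF z e] by metis
  have *: "norm (z v - z u) < e" if "u \<in> {a..b}" "v \<in> {a..b}" "u \<le> v" "v - u < d" for u v
  proof -
    have "{{u..v}} division_of {u..v}"
      using division_of_self[of u v] that(3) by simp
    from d(2)[OF this] show ?thesis using that by auto
  qed
  have "dist (z y) (z x) < e" if "y \<in> {a..b}" "dist y x < d" for y
    using *[of x y] *[of y x] x that
    by (cases "x \<le> y") (auto simp: dist_norm norm_minus_commute)
  with d(1) show "\<exists>d>0. \<forall>x'\<in>{a..b}. dist x' x < d \<longrightarrow> dist (z x') (z x) < e"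
    by blast
qed

text \<open>Comparing increments of \<open>w\<close> with increments of \<open>z\<close> covers two
  uses: \<open>w\<close> a locally Lipschitz function of \<open>z\<close>, and \<open>w\<close>
  Lipschitz in time, where \<open>z\<close> is the identity.\<close>

lemma lipschitz_compose_abs_cont_on:
  assumes z: "abs_cont_on {a..b} z"
    and L: "\<And>s t. s \<in> {a..b} \<Longrightarrow> t \<in> {a..b} \<Longrightarrow> norm (w s - w t) \<le> L * norm (z s - z t)"
  shows "abs_cont_on {a..b} w"
  unfolding abs_cont_on_def
proof (intro allI impI)
  fix e :: real assume e: "e > 0"
  \<comment> \<open>A positive substitute for \<open>L\<close>, so that \<open>e / K\<close> is a
    legitimate tolerance.\<close>
  define K where "K = \<bar>L\<bar> + 1"
  have K: "K > 0" "L \<le> K" by (auto simp: K_def)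
  obtain d where d: "d > 0"
    "\<And>\<D> A. \<lbrakk>\<D> division_of A; A \<subseteq> {a..b}; (\<Sum>k\<in>\<D>. Sup k - Inf k) < d\<rbrakk>
       \<Longrightarrow> (\<Sum>k\<in>\<D>. norm (z (Sup k) - z (Inf k))) < e / K"
    using abs_cont_onD[OF z divide_pos_pos[OF e K(1)]] by metis
  have "(\<Sum>k\<in>\<D>. norm (w (Sup k) - w (Inf k))) < e"
    if div: "\<D> division_of A" and A: "A \<subseteq> {a..b}" and l: "(\<Sum>k\<in>\<D>. Sup k - Inf k) < d" for \<D> A
  proof -
    have "norm (w (Sup k) - w (Inf k)) \<le> K * norm (z (Sup k) - z (Inf k))" if k: "k \<in> \<D>" for k
    proof -
      obtain u v where uv: "k = cbox u v" and ne: "k \<noteq> {}" and sub: "k \<subseteq> A"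
        using division_ofD[OF div] k by metis
      have "Sup k \<in> {a..b}" "Inf k \<in> {a..b}"
        using uv ne order_trans[OF sub A] by (auto simp: subset_iff)
      from L[OF this] K show ?thesis
        by (smt (verit) mult_right_mono norm_ge_zero)
    qed
    then have "(\<Sum>k\<in>\<D>. norm (w (Sup k) - w (Inf k))) \<le> K * (\<Sum>k\<in>\<D>. norm (z (Sup k) - z (Inf k)))"
      by (simp add: sum_distrib_left sum_mono)
    also have "\<dots> < K * (e / K)"
      using d(2)[OF div A l] K by (intro mult_strict_left_mono) auto
    finally show ?thesis using K by simp
  qed
  with d(1) show "\<exists>\<delta>>0. \<forall>\<D> A. \<D> division_of A \<and> A \<subseteq> {a..b} \<and> (\<Sum>k\<in>\<D>. Sup k - Inf k) < \<delta> \<longrightarrow>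
        (\<Sum>k\<in>\<D>. norm (w (Sup k) - w (Inf k))) < e"
    by blast
qed

lemma abs_cont_on_ident: "abs_cont_on {a..b} (\<lambda>t::real. t)"
  unfolding abs_cont_on_def
proof (intro allI impI)
  fix e :: real assume e: "e > 0"
  have "(\<Sum>k\<in>\<D>. norm (Sup k - Inf k)) < e"
    if div: "\<D> division_of A" and l: "(\<Sum>k\<in>\<D>. Sup k - Inf k) < e" for \<D> and A :: "real set"
  proof -
    have "norm (Sup k - Inf k) = Sup k - Inf k" if "k \<in> \<D>" for k
      using division_ofD(3,4)[OF div that] by auto
    then show ?thesis using l by simp
  qed
  with e show "\<exists>\<delta>>0. \<forall>\<D> A. \<D> division_of A \<and> A \<subseteq> {a..b} \<and> (\<Sum>k\<in>\<D>. Sup k - Inf k) < \<delta> \<longrightarrow>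
        (\<Sum>k\<in>\<D>. norm (Sup k - Inf k)) < e"
    by blast
qed

section \<open>The fundamental theorem of calculus for absolutely continuous functions\<close>

text \<open>Absolute continuity speaks of sets of intervals, a Riemann sum of tagged intervals.
  Different tags can share an interval only if it has empty interior, and then the increment of
  \<open>z\<close> vanishes; so forgetting the tags does not change the sum. The total length is the
  measure of the union, hence below that of \<open>U\<close>.\<close>

lemma sum_small_intervals_abs_cont:
  fixes z :: "real \<Rightarrow> 'a::real_normed_vector"
  assumes p: "p tagged_partial_division_of {a..b}"
    and d: "\<And>\<D> A. \<lbrakk>\<D> division_of A; A \<subseteq> {a..b}; (\<Sum>k\<in>\<D>. Sup k - Inf k) < d\<rbrakk>
       \<Longrightarrow> (\<Sum>k\<in>\<D>. norm (z (Sup k) - z (Inf k))) < e"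
    and U: "U \<in> lmeasurable" "measure lebesgue U < d" "\<And>x K. (x, K) \<in> p \<Longrightarrow> K \<subseteq> U"
  shows "(\<Sum>(x, K)\<in>p. norm (z (Sup K) - z (Inf K))) < e"
proof -
  let ?\<D> = "snd ` p" and ?A = "\<Union>(snd ` p)"
  have tag: "p tagged_division_of ?A"
    by (rule tagged_partial_division_of_Union_self[OF p])
  have div: "?\<D> division_of ?A"
    by (rule division_of_tagged_division[OF tag])
  have sub: "?A \<subseteq> {a..b}"
    using tagged_partial_division_ofD(3)[OF p] by (metis UN_least prod.collapse)
  have "(\<Sum>k\<in>?\<D>. Sup k - Inf k) = (\<Sum>k\<in>?\<D>. measure lebesgue k)"
  proof (rule sum.cong)
    fix k assume "k \<in> ?\<D>"
    then obtain u v where "k = {u..v}" "k \<noteq> {}"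
      using division_ofD(3,4)[OF div] by (metis box_real(2))
    then show "Sup k - Inf k = measure lebesgue k" by auto
  qed simp
  also have "\<dots> = measure lebesgue ?A"
    by (rule content_division[OF div])
  also have "\<dots> \<le> measure lebesgue U"
  proof (intro measure_mono_fmeasurable)
    show "?A \<subseteq> U" using U(3) by fastforce
    show "?A \<in> sets lebesgue" using lmeasurable_division[OF div] by (rule fmeasurableD)
  qed (rule U)
  also have "\<dots> < d" by (rule U)
  finally have small: "(\<Sum>k\<in>?\<D>. norm (z (Sup k) - z (Inf k))) < e"
    by (rule d[OF div sub])
  \<comment> \<open>\<open>Sup\<close> and \<open>Inf\<close> of the empty set are unspecified, so
    the increment over an empty interval is set to 0 explicitly.\<close>
  define w where "w K = (if K = {} then 0 else norm (z (Sup K) - z (Inf K)))" for K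
  have "(\<Sum>(x, K)\<in>p. norm (z (Sup K) - z (Inf K))) = (\<Sum>(x, K)\<in>p. w K)"
    using tagged_partial_division_ofD(2)[OF p] by (intro sum.cong) (fastforce simp: w_def)+
  also have "\<dots> = (\<Sum>K\<in>?\<D>. w K)"
  proof (rule sum.over_tagged_division_lemma[OF tag])
    fix u v :: real
    assume "box u v = {}"
    then show "w (cbox u v) = 0"
      by (cases "u = v") (auto simp: w_def)
  qed
  also have "\<dots> = (\<Sum>K\<in>?\<D>. norm (z (Sup K) - z (Inf K)))"
    using division_ofD(3)[OF div] by (intro sum.cong) (auto simp: w_def)
  finally show ?thesis using small by simp
qed

text \<open>The straddle lemma: since \<open>x\<close> lies between \<open>u\<close> and
  \<open>v\<close>, the linearisation errors at the two ends, \<open>e * \<bar>u - x\<bar>\<close>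
  and \<open>e * \<bar>v - x\<bar>\<close>, add up to exactly \<open>e * (v - u)\<close>.\<close>

lemma straddle_derivative:
  fixes z :: "real \<Rightarrow> 'a::real_normed_vector"
  assumes der: "(z has_vector_derivative q) (at x within {a..b})" and e: "e > 0"
  obtains d where "d > 0"
    "\<And>u v. \<lbrakk>u \<in> {a..b}; v \<in> {a..b}; u \<le> x; x \<le> v; \<bar>u - x\<bar> < d; \<bar>v - x\<bar> < d\<rbrakk> \<Longrightarrow>
       norm ((v - u) *\<^sub>R q - (z v - z u)) \<le> e * (v - u)"
proof -
  obtain d where d: "d > 0"
    "\<And>y. y \<in> {a..b} \<Longrightarrow> norm (y - x) < d \<Longrightarrow> norm (z y - z x - (y - x) *\<^sub>R q) \<le> e * norm (y - x)"
    using der[unfolded has_vector_derivative_def has_derivative_within_alt] e by blast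
  have "norm ((v - u) *\<^sub>R q - (z v - z u)) \<le> e * (v - u)"
    if "u \<in> {a..b}" "v \<in> {a..b}" "u \<le> x" "x \<le> v" "\<bar>u - x\<bar> < d" "\<bar>v - x\<bar> < d" for u v
  proof -
    have "(v - u) *\<^sub>R q - (z v - z u) = (z u - z x - (u - x) *\<^sub>R q) - (z v - z x - (v - x) *\<^sub>R q)"
      by (simp add: algebra_simps)
    also have "norm \<dots> \<le> e * norm (u - x) + e * norm (v - x)"
      by (rule order_trans[OF norm_triangle_ineq4 add_mono]) (use d(2)[of u] d(2)[of v] that in auto)
    finally show ?thesis using that by (simp add: algebra_simps)
  qed
  with d(1) that show ?thesis by blast
qed

text \<open>
  The tags in the exceptional null set are given intervals inside an open set of small measure, on
  which absolute continuity controls the increments.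
\<close>

theorem fundamental_theorem_of_calculus_abs_cont:
  fixes z :: "real \<Rightarrow> 'a::euclidean_space"
  assumes ab: "a \<le> b" and ac: "abs_cont_on {a..b} z" and N: "negligible N"
    and der: "\<And>t. t \<in> {a..b} - N \<Longrightarrow> (z has_vector_derivative q t) (at t within {a..b})"
  shows "(q has_integral (z b - z a)) {a..b}"
proof -
  \<comment> \<open>With value 0 on \<open>N\<close>, a tag in \<open>N\<close> contributes only the
    increment of \<open>z\<close> to the error. The change on a null set is undone at the
    end.\<close>
  define r where "r t = (if t \<in> N then 0 else q t)" for t
  have "(r has_integral (z b - z a)) {a..b}"
    unfolding has_integral_real
  proof (intro allI impI)
    fix e :: real assume e: "e > 0"
    \<comment> \<open>The summand 1 keeps the denominator positive for \<open>a = b\<close> and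
      makes the second estimate strict.\<close>
    define e1 where "e1 = e / (2 * (b - a + 1))"
    have e1: "e1 > 0" "e1 * (b - a) < e / 2"
      using e ab by (auto simp: e1_def field_simps)
    obtain d where d: "d > 0"
      "\<And>\<D> A. \<lbrakk>\<D> division_of A; A \<subseteq> {a..b}; (\<Sum>k\<in>\<D>. Sup k - Inf k) < d\<rbrakk>
         \<Longrightarrow> (\<Sum>k\<in>\<D>. norm (z (Sup k) - z (Inf k))) < e / 2"
      using abs_cont_onD[OF ac half_gt_zero[OF e]] by metis
    obtain U where U: "open U" "N \<subseteq> U" "U \<in> lmeasurable" "measure lebesgue U < d"
    proof -
      obtain U where U: "open U" "N \<subseteq> U" "U - N \<in> lmeasurable" "emeasure lebesgue (U - N) < ennreal d"
        using sets_lebesgue_outer_open[OF negligible_imp_sets[OF N] d(1)] by metis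
      have NM: "N \<in> lmeasurable" by (rule negligible_imp_measurable[OF N])
      have eq: "U = (U - N) \<union> N" using U(2) by blast
      have UM: "U \<in> lmeasurable" using fmeasurable.Un[OF U(3) NM] eq by simp
      have "measure lebesgue U \<le> measure lebesgue (U - N) + measure lebesgue N"
        using measure_Un_le[of "U - N" lebesgue N] U(3) NM eq by (simp add: fmeasurableD)
      also have "\<dots> = measure lebesgue (U - N)" using N by (simp add: negligible_imp_measure0)
      also have "\<dots> < d"
        using U(3,4) d(1) by (simp add: emeasure_eq_measure2 ennreal_less_iff)
      finally show ?thesis using that U UM by blast
    qed
    have "\<forall>x. \<exists>\<rho>>0. (x \<in> N \<longrightarrow> ball x \<rho> \<subseteq> U) \<and>
      (x \<in> {a..b} - N \<longrightarrow> (\<forall>u v. u \<in> {a..b} \<and> v \<in> {a..b} \<and> u \<le> x \<and> x \<le> v \<and> \<bar>u - x\<bar> < \<rho> \<and> \<bar>v - x\<bar> < \<rho>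
         \<longrightarrow> norm ((v - u) *\<^sub>R q x - (z v - z u)) \<le> e1 * (v - u)))"
    proof
      fix x
      consider "x \<in> N" | "x \<in> {a..b} - N" | "x \<notin> N" "x \<notin> {a..b}" by blast
      then show "\<exists>\<rho>>0. (x \<in> N \<longrightarrow> ball x \<rho> \<subseteq> U) \<and>
      (x \<in> {a..b} - N \<longrightarrow> (\<forall>u v. u \<in> {a..b} \<and> v \<in> {a..b} \<and> u \<le> x \<and> x \<le> v \<and> \<bar>u - x\<bar> < \<rho> \<and> \<bar>v - x\<bar> < \<rho>
         \<longrightarrow> norm ((v - u) *\<^sub>R q x - (z v - z u)) \<le> e1 * (v - u)))"
      proof cases
        case 1
        then show ?thesis using U(1,2) by (meson DiffE open_contains_ball subsetD)
      next
        case 2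
        then show ?thesis using straddle_derivative[OF der[OF 2] e1(1)] by (metis DiffD2)
      next
        \<comment> \<open>Tags lie in \<open>{a..b}\<close>, but a gauge needs a positive radius at
          every real, so any value does here.\<close>
        case 3
        then show ?thesis by (meson DiffE zero_less_one)
      qed
    qed
    then obtain \<rho> where \<rho>: "\<And>x. \<rho> x > 0" "\<And>x. x \<in> N \<Longrightarrow> ball x (\<rho> x) \<subseteq> U"
      "\<And>x u v. \<lbrakk>x \<in> {a..b} - N; u \<in> {a..b}; v \<in> {a..b}; u \<le> x; x \<le> v; \<bar>u - x\<bar> < \<rho> x; \<bar>v - x\<bar> < \<rho> x\<rbrakk>
         \<Longrightarrow> norm ((v - u) *\<^sub>R q x - (z v - z u)) \<le> e1 * (v - u)"
      by metis
    have "norm ((\<Sum>(x, K)\<in>p. measure lborel K *\<^sub>R r x) - (z b - z a)) < e"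
      if p: "p tagged_division_of {a..b}" and fine: "(\<lambda>x. ball x (\<rho> x)) fine p" for p
    proof -
      have fin: "finite p" using p by blast
      have elem: "\<exists>u v. K = {u..v} \<and> u \<le> v \<and> u \<in> {a..b} \<and> v \<in> {a..b} \<and> u \<le> x \<and> x \<le> v \<and>
          \<bar>u - x\<bar> < \<rho> x \<and> \<bar>v - x\<bar> < \<rho> x \<and> x \<in> {a..b}"
        if xK: "(x, K) \<in> p" for x K
      proof -
        obtain u v where K: "K = {u..v}" using p xK by (metis box_real(2) tagged_division_ofD(4))
        have x: "x \<in> K" "K \<subseteq> {a..b}" using p xK by blast+
        have "K \<subseteq> ball x (\<rho> x)" using fine xK by blast
        then have "u \<in> ball x (\<rho> x)" "v \<in> ball x (\<rho> x)" using K x by (auto simp: subset_iff)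
        then show ?thesis using K x by (intro exI[of _ u] exI[of _ v]) (auto simp: dist_real_def abs_minus_commute subset_iff)
      qed
      define p1 where "p1 = {(x, K) \<in> p. x \<in> N}"
      define p2 where "p2 = {(x, K) \<in> p. x \<notin> N}"
      have pu: "p = p1 \<union> p2" "p1 \<inter> p2 = {}" "finite p1" "finite p2"
        using fin by (auto simp: p1_def p2_def intro: finite_subset[OF _ fin])
      have tz: "z b - z a = (\<Sum>(x, K)\<in>p. z (Sup K) - z (Inf K))"
        using additive_tagged_division_1[OF ab p, of z] by simp
      have ti: "b - a = (\<Sum>(x, K)\<in>p. Sup K - Inf K)"
        using additive_tagged_division_1[OF ab p, of "\<lambda>t. t"] by simp
      define err where "err = (\<lambda>(x, K). measure lborel K *\<^sub>R r x - (z (Sup K) - z (Inf K)))"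
      have "(\<Sum>(x, K)\<in>p. measure lborel K *\<^sub>R r x) - (z b - z a) = sum err p"
        unfolding tz err_def by (simp add: sum_subtractf case_prod_unfold)
      also have "\<dots> = sum err p1 + sum err p2"
        using pu by (simp add: sum.union_disjoint)
      finally have eq: "(\<Sum>(x, K)\<in>p. measure lborel K *\<^sub>R r x) - (z b - z a) = sum err p1 + sum err p2" .
      have "norm (sum err p1) \<le> (\<Sum>(x, K)\<in>p1. norm (z (Sup K) - z (Inf K)))"
        by (rule sum_norm_le) (auto simp: err_def p1_def r_def norm_minus_commute)
      also have "\<dots> < e / 2"
      proof (rule sum_small_intervals_abs_cont[OF _ d(2) U(3,4)])
        show "p1 tagged_partial_division_of {a..b}"
          using p unfolding tagged_division_of_def
          by (rule tagged_partial_division_subset[OF conjunct1]) (auto simp: p1_def)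
        show "K \<subseteq> U" if "(x, K) \<in> p1" for x K
          using that fine \<rho>(2)[of x] unfolding p1_def fine_def by blast
      qed auto
      finally have n1: "norm (sum err p1) < e / 2" .
      have "norm (sum err p2) \<le> (\<Sum>(x, K)\<in>p2. e1 * (Sup K - Inf K))"
      proof (rule sum_norm_le, clarify)
        fix x K assume xK: "(x, K) \<in> p2"
        then have "(x, K) \<in> p" "x \<notin> N" by (auto simp: p2_def)
        then obtain u v where "K = {u..v}" "u \<le> v" "u \<in> {a..b}" "v \<in> {a..b}" "u \<le> x" "x \<le> v"
          "\<bar>u - x\<bar> < \<rho> x" "\<bar>v - x\<bar> < \<rho> x" "x \<in> {a..b}" using elem by metis
        then show "norm (err (x, K)) \<le> e1 * (Sup K - Inf K)"
          using \<rho>(3)[of x u v] \<open>x \<notin> N\<close> by (simp add: err_def r_def)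
      qed
      \<comment> \<open>Enlarging the sum to all of \<open>p\<close> makes the lengths telescope to
        \<open>b - a\<close>.\<close>
      also have "\<dots> \<le> (\<Sum>(x, K)\<in>p. e1 * (Sup K - Inf K))"
      proof (rule sum_mono2[OF fin])
        fix y assume "y \<in> p - p2"
        moreover obtain x K where "y = (x, K)" by (cases y)
        ultimately have y: "y = (x, K)" "(x, K) \<in> p" by auto
        then obtain u v where "K = {u..v}" "u \<le> v" using elem by metis
        then show "0 \<le> (case y of (x, K) \<Rightarrow> e1 * (Sup K - Inf K))"
          using e1(1) by (simp add: y(1))
      qed (use pu in auto)
      also have "\<dots> = e1 * (b - a)"
        unfolding ti by (simp add: sum_distrib_left case_prod_unfold)
      finally have n2: "norm (sum err p2) < e / 2" using e1(2) by simp
      show ?thesis unfolding eq using n1 n2 norm_triangle_ineq[of "sum err p1" "sum err p2"] by simp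
    qed
    moreover have "gauge (\<lambda>x. ball x (\<rho> x))" using \<rho>(1) by (simp add: gauge_def)
    ultimately show "\<exists>\<gamma>. gauge \<gamma> \<and> (\<forall>\<D>. \<D> tagged_division_of {a..b} \<and> \<gamma> fine \<D> \<longrightarrow>
        norm ((\<Sum>(x, k)\<in>\<D>. measure lborel k *\<^sub>R r x) - (z b - z a)) < e)"
      by blast
  qed
  then show ?thesis
    by (rule has_integral_spike[OF N, rotated]) (auto simp: r_def)
qed

section \<open>Peano's theorem for bounded continuous vector fields\<close>

text \<open>A pointwise Arzela-Ascoli theorem on the whole line: a diagonal argument gives
  convergence at the rationals, and the common Lipschitz constant carries the Cauchy property to
  every real.\<close>

lemma equi_lipschitz_convergent_subsequence:
  fixes x :: "nat \<Rightarrow> real \<Rightarrow> 'a::euclidean_space"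
  assumes lip: "\<And>n s t. norm (x n s - x n t) \<le> M * \<bar>s - t\<bar>" and x0: "\<And>n. x n 0 = c"
  obtains k y where "strict_mono (k :: nat \<Rightarrow> nat)" "\<And>t. (\<lambda>n. x (k n) t) \<longlonglongrightarrow> y t"
proof -
  have M: "M \<ge> 0"
    using order_trans[OF norm_ge_zero lip[of 0 1 0]] by simp
  \<comment> \<open>A positive bound for \<open>norm (x n t)\<close>. Division by it makes the
    family bounded by 1 uniformly in \<open>n\<close> and \<open>t\<close>, as the diagonal
    selection requires.\<close>
  define a where "a t = norm c + M * \<bar>t\<bar> + 1" for t :: real
  have a: "a t > 0" for t using M by (simp add: a_def add_nonneg_pos)
  have "norm (x n t /\<^sub>R a t) \<le> 1" for n t
  proof -
    have "norm (x n t) \<le> norm (x n t - x n 0) + norm (x n 0)"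
      by (metis add.commute diff_add_cancel norm_triangle_ineq)
    also have "\<dots> \<le> a t" using lip[of n t 0] by (simp add: a_def x0)
    finally show ?thesis using a[of t] by (simp add: field_simps)
  qed
  then obtain k where k: "strict_mono (k :: nat \<Rightarrow> nat)"
    "\<And>t. t \<in> \<rat> \<Longrightarrow> \<exists>l. (\<lambda>n. x (k n) t /\<^sub>R a t) \<longlonglongrightarrow> l"
    using function_convergent_subsequence[OF countable_rat, of "\<lambda>n t. x n t /\<^sub>R a t" 1] by blast
  have conv_rat: "convergent (\<lambda>n. x (k n) t)" if t: "t \<in> \<rat>" for t
  proof -
    obtain l where "(\<lambda>n. x (k n) t /\<^sub>R a t) \<longlonglongrightarrow> l" using k(2)[OF t] by blast
    from tendsto_scaleR[OF tendsto_const[of "a t"] this] a[of t]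
    have "(\<lambda>n. x (k n) t) \<longlonglongrightarrow> a t *\<^sub>R l" by simp
    then show ?thesis by (rule convergentI)
  qed
  have "Cauchy (\<lambda>n. x (k n) t)" for t
    unfolding Cauchy_iff
  proof (intro allI impI)
    fix e :: real assume e: "e > 0"
    define d where "d = e / (4 * (M + 1))"
    have d: "d > 0" "M * d < e / 3"
      using e M mult_nonneg_nonneg[of M e] by (auto simp: d_def field_simps intro: add_nonneg_pos)
    obtain s where s: "s \<in> \<rat>" "t < s" "s < t + d" using Rats_dense_in_real[of t "t + d"] d by auto
    have b: "norm (x n t - x n s) < e / 3" for n
    proof -
      have "norm (x n t - x n s) \<le> M * \<bar>t - s\<bar>" by (rule lip)
      also have "\<dots> \<le> M * d" using s M by (intro mult_left_mono) auto
      finally show ?thesis using d by simp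
    qed
    obtain N where N: "\<And>m n. m \<ge> N \<Longrightarrow> n \<ge> N \<Longrightarrow> norm (x (k m) s - x (k n) s) < e / 3"
      using convergent_Cauchy[OF conv_rat[OF s(1)]] e unfolding Cauchy_iff
      by (meson divide_pos_pos zero_less_numeral)
    have "norm (x (k m) t - x (k n) t) < e" if "m \<ge> N" "n \<ge> N" for m n
    proof -
      have "x (k m) t - x (k n) t =
          (x (k m) t - x (k m) s) + (x (k m) s - x (k n) s) - (x (k n) t - x (k n) s)" by simp
      also have "norm \<dots> \<le> norm (x (k m) t - x (k m) s) + norm (x (k m) s - x (k n) s)
          + norm (x (k n) t - x (k n) s)"
        by (smt (verit) norm_triangle_ineq norm_triangle_ineq4)
      also have "\<dots> < e" using b[of "k m"] b[of "k n"] N[OF that] by simp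
      finally show ?thesis .
    qed
    then show "\<exists>N. \<forall>m\<ge>N. \<forall>n\<ge>N. norm (x (k m) t - x (k n) t) < e" by blast
  qed
  then have "\<exists>l. (\<lambda>n. x (k n) t) \<longlonglongrightarrow> l" for t
    by (meson Cauchy_convergent convergent_def)
  then show ?thesis using that k(1) by metis
qed

text \<open>
  Tonelli's delayed Picard iterates: the delay makes them stationary on \<open>t \<le> n \<delta>\<close> from step \<open>n\<close> on.
  For \<open>t < 0\<close> the interval is empty, hence the value is \<open>c\<close>.
\<close>

primrec delay_iterate :: "('a::euclidean_space \<Rightarrow> 'a) \<Rightarrow> 'a \<Rightarrow> real \<Rightarrow> nat \<Rightarrow> real \<Rightarrow> 'a" where
  "delay_iterate F c \<delta> 0 = (\<lambda>t. c)"
| "delay_iterate F c \<delta> (Suc n) = (\<lambda>t. c + integral {0..t} (\<lambda>s. F (delay_iterate F c \<delta> n (s - \<delta>))))"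

lemma integral_lipschitz:
  fixes G :: "real \<Rightarrow> 'a::euclidean_space"
  assumes G: "continuous_on UNIV G" and M: "\<And>t. norm (G t) \<le> M"
  shows "norm (integral {0..s} G - integral {0..t} G) \<le> M * \<bar>s - t\<bar>"
proof -
  have M0: "M \<ge> 0" using M[of 0] norm_ge_zero order_trans by blast
  have pos: "norm (integral {0..t} G - integral {0..s} G) \<le> M * (t - s)" if "0 \<le> s" "s \<le> t" for s t
  proof -
    have c: "continuous_on {0..t} G" "continuous_on {s..t} G"
      using G continuous_on_subset by blast+
    have "integral {0..s} G + integral {s..t} G = integral {0..t} G"
      using that by (intro Henstock_Kurzweil_Integration.integral_combine integrable_continuous_real c)
    then have "integral {0..t} G - integral {0..s} G = integral {s..t} G"
      by (simp add: algebra_simps)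
    with integral_bound[OF that(2) c(2), of M] M show ?thesis by simp
  qed
  \<comment> \<open>For \<open>t < 0\<close> the interval is empty. Clamping times at 0 extends the
    estimate to negative arguments, which the delay produces.\<close>
  have mx: "integral {0..t} G = integral {0..max 0 t} G" for t
    by (cases "t < 0") (auto simp: max_def)
  have le: "norm (integral {0..t} G - integral {0..s} G) \<le> M * (t - s)" if "s \<le> t" for s t
  proof -
    have "norm (integral {0..t} G - integral {0..s} G) \<le> M * (max 0 t - max 0 s)"
      using pos[of "max 0 s" "max 0 t"] that mx[of s] mx[of t] by simp
    also have "\<dots> \<le> M * (t - s)" using that M0 by (intro mult_left_mono) auto
    finally show ?thesis .
  qed
  show ?thesis using le[of s t] le[of t s] by (cases "s \<le> t") (auto simp: norm_minus_commute)
qed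

lemma continuous_on_lipschitz:
  fixes G :: "real \<Rightarrow> 'a::real_normed_vector"
  assumes "\<And>s t. norm (G s - G t) \<le> M * \<bar>s - t\<bar>"
  shows "continuous_on UNIV G"
proof (rule lipschitz_on_continuous_on)
  have "M \<ge> 0" using order_trans[OF norm_ge_zero assms[of 1 0]] by simp
  then show "M-lipschitz_on UNIV G"
    using assms by (auto simp: lipschitz_on_def dist_norm)
qed

context
  fixes F :: "'a::euclidean_space \<Rightarrow> 'a" and M :: real
  assumes F: "continuous_on UNIV F" and M: "\<And>x. norm (F x) \<le> M"
begin

lemma continuous_on_delayed:
  assumes "continuous_on UNIV y"
  shows "continuous_on S (\<lambda>s. F (y (s - \<delta> :: real)))"
proof -
  have "continuous_on S (\<lambda>s. s - \<delta>)" by (intro continuous_intros)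
  from continuous_on_compose2[OF assms this]
  have "continuous_on S (\<lambda>s. y (s - \<delta>))" by simp
  from continuous_on_compose2[OF F this] show ?thesis by simp
qed

lemma delay_iterate_lipschitz:
  "norm (delay_iterate F c \<delta> n s - delay_iterate F c \<delta> n t) \<le> M * \<bar>s - t\<bar>"
proof (induction n arbitrary: s t)
  case 0
  have "M \<ge> 0" using M[of 0] norm_ge_zero order_trans by blast
  then show ?case by simp
next
  case (Suc n)
  have "continuous_on UNIV (delay_iterate F c \<delta> n)"
    by (rule continuous_on_lipschitz[OF Suc.IH])
  then have "continuous_on UNIV (\<lambda>s. F (delay_iterate F c \<delta> n (s - \<delta>)))"
    by (rule continuous_on_delayed)
  from integral_lipschitz[OF this M] show ?case by simp
qed

text \<open>Up to time \<open>(n + 1) * \<delta>\<close>, the integrand looks at the previous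
  iterate only at times up to \<open>n * \<delta>\<close>, where the induction hypothesis
  applies.\<close>

lemma delay_iterate_Suc_eq:
  assumes "\<delta> > 0" "t \<le> real n * \<delta>"
  shows "delay_iterate F c \<delta> (Suc n) t = delay_iterate F c \<delta> n t"
  using assms(2)
proof (induction n arbitrary: t)
  case 0
  then have "t < 0 \<or> t = 0" by auto
  then show ?case by auto
next
  case (Suc n)
  have "integral {0..t} (\<lambda>s. F (delay_iterate F c \<delta> (Suc n) (s - \<delta>))) =
      integral {0..t} (\<lambda>s. F (delay_iterate F c \<delta> n (s - \<delta>)))"
    using Suc.prems by (intro integral_cong arg_cong[of _ _ F] Suc.IH) (auto simp: algebra_simps)
  then show ?case by simp
qed

text \<open>Boundedness of \<open>F\<close> makes all delayed solutions Lipschitz with the same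
  constant \<open>M\<close>, on all of the line. A pointwise limit along a subsequence, with the
  delay tending to 0, solves the undelayed equation.\<close>

theorem Peano_global:
  obtains y where "\<And>t. t \<ge> 0 \<Longrightarrow> y t = c + integral {0..t} (\<lambda>s. F (y s))"
    "\<And>s t. norm (y s - y t) \<le> M * \<bar>s - t\<bar>" "y 0 = c"
proof -
  define \<delta> where "\<delta> k = inverse (real (Suc k))" for k
  have \<delta>: "\<delta> k > 0" for k by (simp add: \<delta>_def)
  \<comment> \<open>With delay \<open>1 / (k + 1)\<close>, taking \<open>(k + 1) * (k + 1)\<close>
    iterates gives stationarity up to time \<open>k + 1\<close>; so every fixed \<open>t\<close> is
    eventually covered.\<close>
  define x where "x k = delay_iterate F c (\<delta> k) (Suc k * Suc k)" for k
  have lip: "norm (x k s - x k t) \<le> M * \<bar>s - t\<bar>" for k s t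
    unfolding x_def by (rule delay_iterate_lipschitz)
  have eq: "x k t = c + integral {0..t} (\<lambda>s. F (x k (s - \<delta> k)))" if "t \<le> real (Suc k)" for k t
  proof -
    have "real (Suc k * Suc k) * \<delta> k = real (Suc k)"
      unfolding \<delta>_def of_nat_mult by (simp del: of_nat_Suc)
    then have "x k t = delay_iterate F c (\<delta> k) (Suc (Suc k * Suc k)) t"
      unfolding x_def using that \<delta> by (intro delay_iterate_Suc_eq[symmetric]) auto
    also have "\<dots> = c + integral {0..t} (\<lambda>s. F (x k (s - \<delta> k)))"
      unfolding x_def by (simp only: delay_iterate.simps)
    finally show ?thesis .
  qed
  have x0: "x k 0 = c" for k using eq[of 0 k] by (simp del: of_nat_Suc)
  obtain k y where k: "strict_mono (k :: nat \<Rightarrow> nat)" and y: "\<And>t. (\<lambda>n. x (k n) t) \<longlonglongrightarrow> y t"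
    using equi_lipschitz_convergent_subsequence[of x M c, OF lip x0] by blast
  have lipy: "norm (y s - y t) \<le> M * \<bar>s - t\<bar>" for s t
    by (rule LIMSEQ_le_const2[OF tendsto_norm[OF tendsto_diff[OF y y]]]) (use lip in auto)
  have y0: "y 0 = c"
    using LIMSEQ_unique[OF y[of 0]] by (simp add: x0)
  have \<delta>0: "(\<lambda>n. \<delta> (k n)) \<longlonglongrightarrow> 0"
    using LIMSEQ_subseq_LIMSEQ[OF LIMSEQ_inverse_real_of_nat k] by (simp add: \<delta>_def o_def)
  have "y t = c + integral {0..t} (\<lambda>s. F (y s))" if t: "t \<ge> 0" for t
  proof -
    have lim: "(\<lambda>n. F (x (k n) (s - \<delta> (k n)))) \<longlonglongrightarrow> F (y s)" for s
    proof -
      have "(\<lambda>n. x (k n) (s - \<delta> (k n)) - x (k n) s) \<longlonglongrightarrow> 0"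
      proof (rule tendsto_0_le[OF \<delta>0, of _ M], intro always_eventually allI)
        fix n show "norm (x (k n) (s - \<delta> (k n)) - x (k n) s) \<le> norm (\<delta> (k n)) * M"
          using lip[of "k n" "s - \<delta> (k n)" s] by (simp add: mult.commute)
      qed
      from tendsto_add[OF this y[of s]] have "(\<lambda>n. x (k n) (s - \<delta> (k n))) \<longlonglongrightarrow> y s" by simp
      then show ?thesis
        using F continuous_on_eq_continuous_at isCont_tendsto_compose by blast
    qed
    have int: "(\<lambda>s. F (x j (s - \<delta> j))) integrable_on {0..t}" for j
      by (intro integrable_continuous_real continuous_on_delayed continuous_on_lipschitz[OF lip])
    \<comment> \<open>The constant \<open>M\<close> dominates the integrands, so pointwise
      convergence suffices.\<close>
    have "(\<lambda>n. integral {0..t} (\<lambda>s. F (x (k n) (s - \<delta> (k n))))) \<longlonglongrightarrow> integral {0..t} (\<lambda>s. F (y s))"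
      by (rule dominated_convergence(2)[of _ _ "\<lambda>_. M"]) (use int lim M in auto)
    then have "(\<lambda>n. c + integral {0..t} (\<lambda>s. F (x (k n) (s - \<delta> (k n))))) \<longlonglongrightarrow>
        c + integral {0..t} (\<lambda>s. F (y s))" by (intro tendsto_intros)
    moreover have "\<forall>\<^sub>F n in sequentially. c + integral {0..t} (\<lambda>s. F (x (k n) (s - \<delta> (k n)))) = x (k n) t"
    proof (rule eventually_sequentiallyI[of "nat \<lceil>t\<rceil>"])
      fix n assume "nat \<lceil>t\<rceil> \<le> n"
      then have "t \<le> real (Suc (k n))"
        using strict_mono_imp_increasing[OF k, of n] by linarith
      then show "c + integral {0..t} (\<lambda>s. F (x (k n) (s - \<delta> (k n)))) = x (k n) t"
        using eq by simp
    qed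
    ultimately have "(\<lambda>n. x (k n) t) \<longlonglongrightarrow> c + integral {0..t} (\<lambda>s. F (y s))"
      by (rule Lim_transform_eventually)
    then show ?thesis by (rule LIMSEQ_unique[OF y])
  qed
  with lipy y0 that show ?thesis by blast
qed

end

section \<open>Energy along trajectories and integrals over the half line\<close>

text \<open>\<open>H\<close> is Lipschitz on a ball containing the compact image of
  \<open>z\<close>. The ball is used because the mean value inequality needs a convex set.\<close>

lemma C1_compose_abs_cont_on:
  assumes H: "C1 H" and z: "abs_cont_on {a..b} z"
  shows "abs_cont_on {a..b} (\<lambda>t. H (z t))"
proof -
  have "compact (z ` {a..b})"
    by (intro compact_continuous_image abs_cont_on_imp_continuous_on z) simp
  then obtain R where R: "\<And>t. t \<in> {a..b} \<Longrightarrow> z t \<in> cball 0 R"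
    using bounded_subset_cbox_symmetric compact_imp_bounded by (metis bounded_iff imageI mem_cball_0)
  have "compact (gradient H ` cball 0 R)"
    using H unfolding C1_def by (metis compact_cball compact_continuous_image continuous_on_subset subset_UNIV)
  then obtain B where B: "\<And>x. x \<in> cball 0 R \<Longrightarrow> norm (gradient H x) \<le> B"
    using compact_imp_bounded bounded_iff by (metis imageI)
  have der: "(H has_derivative (\<lambda>v. v \<bullet> gradient H x)) (at x within cball 0 R)" for x
    using gderiv_gradient H unfolding C1_def gderiv_def by (blast intro: has_derivative_at_withinI)
  show ?thesis
  proof (rule lipschitz_compose_abs_cont_on[OF z])
    fix s t assume "s \<in> {a..b}" "t \<in> {a..b}"
    then show "norm (H (z s) - H (z t)) \<le> B * norm (z s - z t)"
    proof (intro differentiable_bound[OF convex_cball der] R)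
      fix x :: 'a assume x: "x \<in> cball 0 R"
      show "onorm (\<lambda>v. v \<bullet> gradient H x) \<le> B"
      proof (rule onorm_le)
        fix v
        have "norm (v \<bullet> gradient H x) \<le> norm v * norm (gradient H x)"
          by (simp add: Cauchy_Schwarz_ineq2)
        also have "\<dots> \<le> norm v * B" by (intro mult_left_mono B x) simp
        finally show "norm (v \<bullet> gradient H x) \<le> B * norm v" by (simp add: mult.commute)
      qed
    qed auto
  qed
qed

lemma C1_chain_rule:
  assumes H: "C1 H" and z: "(z has_vector_derivative v) (at t within S)"
  shows "((\<lambda>t. H (z t)) has_vector_derivative (gradient H (z t) \<bullet> v)) (at t within S)"
proof -
  have "(H has_derivative (\<lambda>v. v \<bullet> gradient H (z t))) (at (z t))"
    using gderiv_gradient H unfolding C1_def gderiv_def by blast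
  from has_derivative_compose[OF z[unfolded has_vector_derivative_def] this]
  show ?thesis by (simp add: has_vector_derivative_def inner_commute)
qed

lemma AE_halfline_negligible:
  assumes "AE t in lebesgue_on {0::real..}. P t"
  obtains N where "negligible N" "\<And>t. t \<ge> 0 \<Longrightarrow> t \<notin> N \<Longrightarrow> P t"
proof -
  have "AE t in lebesgue. t \<in> {0..} \<longrightarrow> P t"
    using assms by (subst (asm) AE_restrict_space_iff) auto
  then obtain N where "N \<in> null_sets lebesgue" "{t \<in> space lebesgue. \<not> (t \<in> {0..} \<longrightarrow> P t)} \<subseteq> N"
    by (auto simp: eventually_ae_filter)
  then show ?thesis
    by (intro that[of N]) (auto simp: negligible_iff_null_sets)
qed

lemma trajectory_continuous_on:
  assumes "trajectory f g z0 u z"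
  shows "continuous_on {0..} z"
  unfolding continuous_on_eq_continuous_within
proof
  fix t :: real assume t: "t \<in> {0..}"
  \<comment> \<open>Room beyond \<open>t\<close> keeps it from being a right endpoint, so both
    filters at \<open>t\<close> agree.\<close>
  have "continuous_on {0..t + 1} z"
    using assms t unfolding trajectory_def by (intro abs_cont_on_imp_continuous_on) auto
  then have "continuous (at t within {0..t + 1}) z"
    using t by (auto simp: continuous_on_eq_continuous_within)
  moreover have "at t within {0..t + 1} = at t within {0..}"
    by (rule at_within_nhd[of _ "{..<t + 1}"]) auto
  ultimately show "continuous (at t within {0..}) z" by simp
qed

text \<open>Transfers values from the gauge integral of the energy balance to the Lebesgue integral
  of the cost.\<close>

lemma nn_integral_halfline_Icc:
  fixes c :: "real \<Rightarrow> real"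
  assumes c: "\<And>t. t \<in> {0..T} \<Longrightarrow> c t \<ge> 0" and I: "(c has_integral I) {0..T}"
  shows "(\<integral>\<^sup>+ t. ennreal (c t) * indicator {0..T} t \<partial>lebesgue_on {0..}) = ennreal I"
proof -
  have "(\<integral>\<^sup>+ t. ennreal (c t) * indicator {0..T} t \<partial>lebesgue_on {0..}) =
      (\<integral>\<^sup>+ t. ennreal (c t) * indicator {0..T} t \<partial>lebesgue)"
    by (subst nn_integral_restrict_space) (auto intro!: nn_integral_cong simp: indicator_def)
  also have "\<dots> = ennreal I"
    using nn_integral_has_integral_lebesgue'[OF c I] by (simp add: nn_integral_completion)
  finally show ?thesis .
qed

lemma trajectory_of_integral_equation:
  fixes z :: "real \<Rightarrow> 'a::euclidean_space"
  assumes F: "continuous_on UNIV F"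
    and z: "\<And>t. t \<ge> 0 \<Longrightarrow> z t = z0 + integral {0..t} (\<lambda>s. F (z s))"
    and lip: "\<And>s t. norm (z s - z t) \<le> M * \<bar>s - t\<bar>"
    and t: "t \<ge> 0"
  shows "(z has_vector_derivative F (z t)) (at t within {0..})"
proof -
  have "continuous_on {0..t + 1} (\<lambda>s. F (z s))"
    using continuous_on_lipschitz[OF lip] by (auto intro: continuous_on_compose2[OF F] continuous_on_subset)
  from integral_has_vector_derivative[OF this, of t] t
  have "((\<lambda>s. z0 + integral {0..s} (\<lambda>s. F (z s))) has_vector_derivative F (z t)) (at t within {0..t + 1})"
    by (auto intro!: derivative_eq_intros)
  then have "(z has_vector_derivative F (z t)) (at t within {0..t + 1})"
    by (rule has_vector_derivative_transform[rotated 2]) (use t z in auto)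
  moreover have "at t within {0..t + 1} = at t within {0..}"
    by (rule at_within_nhd[of _ "{..<t + 1}"]) auto
  ultimately show ?thesis by simp
qed

section \<open>Energy balance and the lower bound for the cost\<close>

locale lossless_system =
  fixes f :: "real^'n \<Rightarrow> real^'n" and g :: "real^'n \<Rightarrow> real^'m^'n"
    and h :: "real^'n \<Rightarrow> real^'m" and l :: "real^'n \<Rightarrow> real^'p" and H :: "real^'n \<Rightarrow> real"
  assumes f: "continuous_on UNIV f" and g: "continuous_on UNIV g"
    and h: "continuous_on UNIV h" and l: "continuous_on UNIV l"
    and C1: "C1 H" and H_nonneg: "H x \<ge> 0"
    and dissipation: "gradient H x \<bullet> f x = - (l x \<bullet> l x)"
    and output_eq: "transpose (g x) *v gradient H x = h x"
    and radial: "filterlim H at_top at_infinity"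
    and H_zero: "H 0 = 0" and H_pos: "x \<noteq> 0 \<Longrightarrow> H x > 0"
    and detectable: "x \<noteq> 0 \<Longrightarrow> l x \<bullet> l x + h x \<bullet> h x > 0"
begin

text \<open>The power balance: \<open>h x \<bullet> v\<close> is the power supplied through the
  input, because \<open>output_eq\<close> makes \<open>h\<close> dual to the input matrix, and
  \<open>l x \<bullet> l x\<close> is the dissipated power.\<close>

lemma gradient_inner_rhs: "gradient H x \<bullet> (f x + g x *v v) = h x \<bullet> v - l x \<bullet> l x"
proof -
  have "gradient H x \<bullet> (g x *v v) = h x \<bullet> v"
    unfolding output_eq[symmetric] by (simp add: dot_lmul_matrix flip: vector_transpose_matrix)
  then show ?thesis by (simp add: inner_add_right dissipation)
qed

lemma H_continuous: "continuous_on S H"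
proof -
  have "H differentiable (at x)" for x using C1 by (simp add: C1_def)
  then show ?thesis
    by (meson continuous_at_imp_continuous_on differentiable_imp_continuous_within)
qed

text \<open>Radial unboundedness enters here; this compactness bounds the cut-off vector field and
  provides the minima in the stability proof.\<close>

lemma compact_sublevel: "compact {x. H x \<le> c}"
proof -
  have "eventually (\<lambda>x. H x > c) at_infinity"
    using radial by (simp add: filterlim_at_top_dense)
  then obtain b where b: "\<And>x. norm x \<ge> b \<Longrightarrow> H x > c" by (auto simp: eventually_at_infinity)
  have "bounded {x. H x \<le> c}"
    unfolding bounded_iff by (intro exI[of _ b]) (meson b linorder_not_le mem_Collect_eq nle_le)
  moreover have "closed {x. H x \<le> c}"
    by (intro closed_Collect_le H_continuous continuous_on_const)
  ultimately show ?thesis by (simp add: compact_eq_bounded_closed)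
qed

lemma energy_balance:
  assumes tr: "trajectory f g z0 u z" and T: "T \<ge> 0"
  shows "((\<lambda>t. h (z t) \<bullet> u t - l (z t) \<bullet> l (z t)) has_integral (H (z T) - H z0)) {0..T}"
proof -
  obtain N where N: "negligible N" "\<And>t. t \<ge> 0 \<Longrightarrow> t \<notin> N \<Longrightarrow>
      (z has_vector_derivative (f (z t) + g (z t) *v u t)) (at t within {0..})"
  proof -
    have "AE t in lebesgue_on {0..}.
        (z has_vector_derivative (f (z t) + g (z t) *v u t)) (at t within {0..})"
      using tr by (simp add: trajectory_def)
    then show ?thesis using AE_halfline_negligible that by blast
  qed
  have z: "abs_cont_on {0..T} z" "z 0 = z0" using tr T by (auto simp: trajectory_def)
  have "((\<lambda>t. h (z t) \<bullet> u t - l (z t) \<bullet> l (z t)) has_integral (H (z T) - H (z 0))) {0..T}"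
  proof (rule fundamental_theorem_of_calculus_abs_cont[OF T C1_compose_abs_cont_on[OF C1 z(1)] N(1)])
    fix t assume t: "t \<in> {0..T} - N"
    have "(z has_vector_derivative (f (z t) + g (z t) *v u t)) (at t within {0..T})"
      by (rule has_vector_derivative_within_subset[OF N(2)]) (use t in auto)
    from C1_chain_rule[OF C1 this]
    show "((\<lambda>t. H (z t)) has_vector_derivative h (z t) \<bullet> u t - l (z t) \<bullet> l (z t)) (at t within {0..T})"
      by (simp add: gradient_inner_rhs)
  qed
  then show ?thesis by (simp add: z)
qed

lemma running_cost_measurable:
  assumes tr: "trajectory f g z0 u z" and u: "u \<in> borel_measurable (lebesgue_on {0..})"
  shows "(\<lambda>t. h (z t) \<bullet> h (z t) + 2 * (l (z t) \<bullet> l (z t)) + u t \<bullet> u t)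
      \<in> borel_measurable (lebesgue_on {0..})"
proof -
  note z = trajectory_continuous_on[OF tr]
  have "(\<lambda>t. h (z t) \<bullet> h (z t) + 2 * (l (z t) \<bullet> l (z t))) \<in> borel_measurable (lebesgue_on {0..})"
    by (intro continuous_imp_measurable_on_sets_lebesgue continuous_intros
        continuous_on_compose2[OF h z] continuous_on_compose2[OF l z]) auto
  from borel_measurable_add[OF this borel_measurable_inner[OF u u]] show ?thesis .
qed

text \<open>On \<open>{0..T}\<close> the estimate loses only the integral of the completed square,
  and the remaining half line contributes a nonnegative amount. A negative left-hand difference
  becomes 0 under \<open>ennreal\<close>.\<close>

lemma cost_lower_bound:
  assumes tr: "trajectory f g z0 u z" and u: "L2_control u" and T: "T \<ge> 0"
  shows "ennreal (H z0 - H (z T)) \<le> cost h l z u"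
proof (cases "cost h l z u = \<infinity>")
  case False
  define c where "c t = h (z t) \<bullet> h (z t) + 2 * (l (z t) \<bullet> l (z t)) + u t \<bullet> u t" for t
  have cost: "cost h l z u = ennreal (1/2) * (\<integral>\<^sup>+ t. ennreal (c t) \<partial>lebesgue_on {0..})"
    by (simp add: cost_def c_def)
  have c0: "c t \<ge> 0" for t by (simp add: c_def)
  \<comment> \<open>Finite cost makes \<open>c\<close> integrable, which allows the comparison with
    the balance on \<open>{0..T}\<close>.\<close>
  have "integrable (lebesgue_on {0..}) c"
  proof (rule integrableI_nonneg)
    show "c \<in> borel_measurable (lebesgue_on {0..})"
      using running_cost_measurable[OF tr] u unfolding c_def L2_control_def by blast
    show "(\<integral>\<^sup>+ t. ennreal (c t) \<partial>lebesgue_on {0..}) < \<infinity>"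
      using False unfolding cost by (auto simp: ennreal_mult_eq_top_iff less_top)
  qed (use c0 in auto)
  then have "c absolutely_integrable_on {0..}"
    by (simp add: integrable_restrict_space set_integrable_def)
  then have "c absolutely_integrable_on {0..T}"
    by (rule set_integrable_subset) auto
  then have "c integrable_on {0..T}"
    by (rule set_lebesgue_integral_eq_integral(1))
  then obtain I where I: "(c has_integral I) {0..T}" by blast
  have "((\<lambda>t. - 2 * (h (z t) \<bullet> u t - l (z t) \<bullet> l (z t))) has_integral - 2 * (H (z T) - H z0)) {0..T}"
    by (intro has_integral_mult_right energy_balance[OF tr T])
  then have "- 2 * (H (z T) - H z0) \<le> I"
  proof (rule has_integral_le[OF _ I])
    fix t
    have "0 \<le> (h (z t) + u t) \<bullet> (h (z t) + u t)" by simp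
    then show "- 2 * (h (z t) \<bullet> u t - l (z t) \<bullet> l (z t)) \<le> c t"
      by (simp add: c_def inner_add_left inner_add_right inner_commute)
  qed
  then have "ennreal (H z0 - H (z T)) \<le> ennreal (1/2 * I)" by (intro ennreal_leI) simp
  also have "\<dots> = ennreal (1/2) * ennreal I" by (rule ennreal_mult') simp
  also have "ennreal I = (\<integral>\<^sup>+ t. ennreal (c t) * indicator {0..T} t \<partial>lebesgue_on {0..})"
    by (rule nn_integral_halfline_Icc[symmetric, OF c0 I])
  also have "ennreal (1/2) * \<dots> \<le> cost h l z u"
    unfolding cost by (intro mult_left_mono nn_integral_mono) (auto simp: indicator_def)
  finally show ?thesis .
qed simp

lemma admissible_cost_ge:
  assumes "(z, u) \<in> admissible f g h l z0"
  shows "ennreal (H z0) \<le> cost h l z u"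
proof -
  have tr: "trajectory f g z0 u z" "L2_control u" and lim: "(z \<longlongrightarrow> 0) at_top"
    using assms by (auto simp: admissible_def)
  have "((\<lambda>t. H (z t)) \<longlongrightarrow> H 0) at_top"
    using H_continuous[of UNIV] by (intro isCont_tendsto_compose[OF _ lim]) (simp add: continuous_on_eq_continuous_at)
  then have "((\<lambda>t. ennreal (H z0 - H (z t))) \<longlongrightarrow> ennreal (H z0 - 0)) at_top"
    by (intro tendsto_ennrealI tendsto_intros) (simp add: H_zero)
  then have "ennreal (H z0 - 0) \<le> cost h l z u"
    by (rule tendsto_upperbound) (auto intro!: cost_lower_bound[OF tr] eventually_at_top_linorderI[of 0])
  then show ?thesis by simp
qed

section \<open>Stability, optimality and solvability of the closed loop\<close>

lemma closed_loop_dissipation: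
  assumes tr: "trajectory f g z0 (\<lambda>t. - h (z t)) z" and T: "T \<ge> 0"
  shows "((\<lambda>t. l (z t) \<bullet> l (z t) + h (z t) \<bullet> h (z t)) has_integral (H z0 - H (z T))) {0..T}"
  using has_integral_neg[OF energy_balance[OF tr T]] by (simp add: algebra_simps)

lemma closed_loop_antimono:
  assumes tr: "trajectory f g z0 (\<lambda>t. - h (z t)) z" and "0 \<le> s" "s \<le> t"
  shows "H (z t) \<le> H (z s)"
proof -
  have "H z0 - H (z s) \<le> H z0 - H (z t)"
    by (rule has_integral_subset_le[OF _ closed_loop_dissipation[OF tr] closed_loop_dissipation[OF tr]])
      (use assms in auto)
  then show ?thesis by simp
qed

text \<open>Energy dissipated at a uniform positive rate would eventually exceed the initial supply
  \<open>H z0\<close>. One time \<open>T\<close> is enough, as \<open>H\<close> is nonincreasing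
  afterwards.\<close>

lemma closed_loop_energy_small:
  assumes tr: "trajectory f g z0 (\<lambda>t. - h (z t)) z" and c: "c > 0"
  obtains T where "T \<ge> 0" "H (z T) < c"
proof -
  have False if big: "\<And>T. T \<ge> 0 \<Longrightarrow> H (z T) \<ge> c"
  proof -
    let ?w = "\<lambda>x. l x \<bullet> l x + h x \<bullet> h x"
    have z0: "z 0 = z0" using tr by (simp add: trajectory_def)
    define K where "K = {x. H x \<le> H z0} \<inter> {x. c \<le> H x}"
    have "closed {x. c \<le> H x}"
      by (intro closed_Collect_le H_continuous continuous_on_const)
    then have "compact K" unfolding K_def by (intro compact_Int_closed compact_sublevel)
    have zK: "z t \<in> K" if "t \<ge> 0" for t
      using big[OF that] closed_loop_antimono[OF tr, of 0 t] that by (simp add: K_def z0)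
    then have "K \<noteq> {}" by fastforce
    have "continuous_on K ?w"
      by (intro continuous_intros continuous_on_subset[OF h] continuous_on_subset[OF l]) auto
    then obtain x where x: "x \<in> K" "\<And>y. y \<in> K \<Longrightarrow> ?w x \<le> ?w y"
      using continuous_attains_inf[OF \<open>compact K\<close> \<open>K \<noteq> {}\<close>] by blast
    have "x \<noteq> 0" using x(1) c H_zero by (auto simp: K_def)
    then have pos: "?w x > 0" by (rule detectable)
    have "?w x * T \<le> H z0" if T: "T \<ge> 0" for T
    proof -
      have "((\<lambda>_. ?w x) has_integral ?w x * T) {0..T}"
        using has_integral_const_real[of "?w x" 0 T] T by (simp add: mult.commute)
      then have "?w x * T \<le> H z0 - H (z T)"
        by (rule has_integral_le[OF _ closed_loop_dissipation[OF tr T]]) (use x zK in auto)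
      then show ?thesis using H_nonneg[of "z T"] by simp
    qed
    \<comment> \<open>At this time the dissipated energy would be at least
      \<open>H z0 + 1\<close>.\<close>
    from this[of "(H z0 + 1) / ?w x"] show False
      using pos H_nonneg[of z0] by (simp add: field_simps)
  qed
  then show ?thesis using that by (meson not_le)
qed

text \<open>Small energy is turned into small norm: \<open>H\<close> has a positive lower bound
  \<open>c\<close> on the part of the sublevel set outside the ball of radius \<open>e\<close>, so
  once the energy is below \<open>c\<close> the state stays in that ball.\<close>

lemma closed_loop_tendsto_0:
  assumes tr: "trajectory f g z0 (\<lambda>t. - h (z t)) z"
  shows "(z \<longlongrightarrow> 0) at_top"
proof (rule tendstoI)
  fix e :: real assume e: "e > 0"
  have z0: "z 0 = z0" using tr by (simp add: trajectory_def)
  define K where "K = {x. H x \<le> H z0} \<inter> {x. e \<le> norm x}"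
  have "closed {x :: real^'n. e \<le> norm x}"
    by (intro closed_Collect_le continuous_intros)
  then have "compact K" unfolding K_def by (intro compact_Int_closed compact_sublevel)
  obtain c where c: "c > 0" "\<And>x. x \<in> K \<Longrightarrow> c \<le> H x"
  proof (cases "K = {}")
    case False
    then obtain x where x: "x \<in> K" "\<And>y. y \<in> K \<Longrightarrow> H x \<le> H y"
      using continuous_attains_inf[OF \<open>compact K\<close> _ H_continuous] by blast
    have "x \<noteq> 0" using x(1) e by (auto simp: K_def)
    then show ?thesis using that[of "H x"] x(2) H_pos by blast
  qed (use that[of 1] in auto)
  obtain T where T: "T \<ge> 0" "H (z T) < c" using closed_loop_energy_small[OF tr c(1)] by blast
  show "\<forall>\<^sub>F t in at_top. dist (z t) 0 < e"
  proof (rule eventually_at_top_linorderI)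
    fix t assume t: "T \<le> t"
    then have "H (z t) < c" "H (z t) \<le> H z0"
      using closed_loop_antimono[OF tr, of T t] closed_loop_antimono[OF tr, of 0 t] T by (auto simp: z0)
    then have "z t \<notin> K" using c(2) by fastforce
    then show "dist (z t) 0 < e" using \<open>H (z t) \<le> H z0\<close> by (auto simp: K_def)
  qed
qed

text \<open>For this control the running cost is exactly twice the dissipation rate, so truncated
  integrals are at most \<open>2 * H z0\<close>. This gives finite cost and admissibility, after
  which the general lower bound turns the estimate into equality.\<close>

lemma closed_loop_admissible:
  assumes tr: "trajectory f g z0 (\<lambda>t. - h (z t)) z"
  shows "(z, \<lambda>t. - h (z t)) \<in> admissible f g h l z0" "cost h l z (\<lambda>t. - h (z t)) = ennreal (H z0)"
proof -
  let ?u = "\<lambda>t. - h (z t)"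
  let ?M = "lebesgue_on {0..}"
  define c where "c t = h (z t) \<bullet> h (z t) + 2 * (l (z t) \<bullet> l (z t)) + ?u t \<bullet> ?u t" for t
  have c0: "c t \<ge> 0" for t by (simp add: c_def)
  have u: "?u \<in> borel_measurable ?M"
    by (intro continuous_imp_measurable_on_sets_lebesgue continuous_intros
        continuous_on_compose2[OF h trajectory_continuous_on[OF tr]]) auto
  have cM: "c \<in> borel_measurable ?M"
    unfolding c_def by (rule running_cost_measurable[OF tr u])
  have part: "(\<integral>\<^sup>+ t. ennreal (c t) * indicator {0..real n} t \<partial>?M) \<le> ennreal (2 * H z0)" for n
  proof -
    have "((\<lambda>t. 2 * (l (z t) \<bullet> l (z t) + h (z t) \<bullet> h (z t))) has_integral 2 * (H z0 - H (z n))) {0..real n}"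
      by (intro has_integral_mult_right closed_loop_dissipation[OF tr]) simp
    then have "(c has_integral 2 * (H z0 - H (z n))) {0..real n}"
      by (simp add: c_def[abs_def] algebra_simps)
    from nn_integral_halfline_Icc[OF c0 this] show ?thesis
      using H_nonneg[of "z n"] by (auto intro: ennreal_leI)
  qed
  have "(\<integral>\<^sup>+ t. ennreal (c t) \<partial>?M) = (\<integral>\<^sup>+ t. (SUP n. ennreal (c t) * indicator {0..real n} t) \<partial>?M)"
  proof (rule nn_integral_cong)
    fix t :: real assume "t \<in> space ?M"
    then have t: "t \<ge> 0" by simp
    show "ennreal (c t) = (SUP n. ennreal (c t) * indicator {0..real n} t)"
    proof (rule antisym)
      have "ennreal (c t) = ennreal (c t) * indicator {0..real (nat \<lceil>t\<rceil>)} t"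
        using t by (simp add: indicator_def)
      also have "\<dots> \<le> (SUP n. ennreal (c t) * indicator {0..real n} t)" by (rule SUP_upper) simp
      finally show "ennreal (c t) \<le> (SUP n. ennreal (c t) * indicator {0..real n} t)" .
    qed (auto intro!: SUP_least simp: indicator_def)
  qed
  also have "\<dots> = (SUP n. \<integral>\<^sup>+ t. ennreal (c t) * indicator {0..real n} t \<partial>?M)"
  proof (rule nn_integral_monotone_convergence_SUP)
    show "incseq (\<lambda>n t. ennreal (c t) * indicator {0..real n} t)"
      by (auto simp: incseq_def le_fun_def indicator_def)
    show "(\<lambda>t. ennreal (c t) * indicator {0..real n} t) \<in> borel_measurable ?M" for n
      using cM by (intro borel_measurable_times_ennreal measurable_compose[OF _ measurable_ennreal]
          borel_measurable_indicator) (auto simp: sets_restrict_space_iff)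
  qed
  also have "\<dots> \<le> ennreal (2 * H z0)" by (intro SUP_least part)
  finally have fin: "(\<integral>\<^sup>+ t. ennreal (c t) \<partial>?M) \<le> ennreal (2 * H z0)" .
  have cost: "cost h l z ?u = ennreal (1/2) * (\<integral>\<^sup>+ t. ennreal (c t) \<partial>?M)"
    by (simp add: cost_def c_def)
  also have "\<dots> \<le> ennreal (1/2) * ennreal (2 * H z0)" by (intro mult_left_mono fin) simp
  also have "\<dots> = ennreal (H z0)" by (subst ennreal_mult'[symmetric]) auto
  finally have le: "cost h l z ?u \<le> ennreal (H z0)" .
  have "integrable ?M (\<lambda>t. (norm (?u t))\<^sup>2)"
  proof (rule integrableI_nonneg)
    \<comment> \<open>The squared control is a summand of the running cost.\<close>
    have "(\<integral>\<^sup>+ t. ennreal ((norm (?u t))\<^sup>2) \<partial>?M) \<le> (\<integral>\<^sup>+ t. ennreal (c t) \<partial>?M)"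
      by (intro nn_integral_mono ennreal_leI) (simp add: c_def power2_norm_eq_inner)
    also note fin
    finally show "(\<integral>\<^sup>+ t. ennreal ((norm (?u t))\<^sup>2) \<partial>?M) < \<infinity>"
      using le_less_trans by force
  qed (use u in auto)
  then show adm: "(z, ?u) \<in> admissible f g h l z0"
    using tr u le closed_loop_tendsto_0[OF tr] le_less_trans[OF le]
    by (auto simp: admissible_def L2_control_def)
  show "cost h l z ?u = ennreal (H z0)"
    using le admissible_cost_ge[OF adm] by (rule antisym)
qed

text \<open>
  The vector field is cut off outside a sublevel set to make it bounded; since \<open>H\<close> still decreases
  along the solutions of the modified equation, these never feel the cutoff.
\<close>

lemma closed_loop_exists:
  obtains z where "trajectory f g z0 (\<lambda>t. - h (z t)) z"
proof -
  \<comment> \<open>Equal to 1 where \<open>H x \<le> H z0\<close>, equal to 0 where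
    \<open>H x \<ge> H z0 + 1\<close>, and continuous in between.\<close>
  define cutoff where "cutoff x = max 0 (min 1 (H z0 + 1 - H x))" for x
  define G where "G x = f x + g x *v (- h x)" for x
  define F where "F x = cutoff x *\<^sub>R G x" for x
  have G: "continuous_on S G" for S
  proof -
    have "continuous_on UNIV G"
      unfolding G_def matrix_vector_mult_def
      by (intro continuous_intros f h g continuous_on_vec_lambda continuous_on_component)
    then show ?thesis by (rule continuous_on_subset) simp
  qed
  have F: "continuous_on UNIV F"
    unfolding F_def cutoff_def by (intro continuous_intros G H_continuous)
  have "bounded (G ` {x. H x \<le> H z0 + 1})"
    by (intro compact_imp_bounded compact_continuous_image compact_sublevel G)
  then obtain B where B: "\<And>x. H x \<le> H z0 + 1 \<Longrightarrow> norm (G x) \<le> B" unfolding bounded_iff by blast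
  have "norm (F x) \<le> max 0 B" for x
  proof (cases "H x \<le> H z0 + 1")
    case True
    have "norm (F x) \<le> 1 * norm (G x)"
      unfolding F_def norm_scaleR by (intro mult_right_mono) (auto simp: cutoff_def)
    then show ?thesis using B[OF True] by simp
  qed (simp add: F_def cutoff_def)
  then obtain z where z: "\<And>t. t \<ge> 0 \<Longrightarrow> z t = z0 + integral {0..t} (\<lambda>s. F (z s))"
    and lip: "\<And>s t. norm (z s - z t) \<le> max 0 B * \<bar>s - t\<bar>" and z0: "z 0 = z0"
    using Peano_global[OF F] by metis
  have der: "(z has_vector_derivative F (z t)) (at t within {0..})" if "t \<ge> 0" for t
    by (rule trajectory_of_integral_equation[OF F z lip that])
  have "H (z T) \<le> H z0" if T: "T \<ge> 0" for T
  proof -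
    have "((\<lambda>t. gradient H (z t) \<bullet> F (z t)) has_integral (H (z T) - H (z 0))) {0..T}"
    proof (rule fundamental_theorem_of_calculus[OF T])
      fix t assume "t \<in> {0..T}"
      then have "(z has_vector_derivative F (z t)) (at t within {0..T})"
        by (intro has_vector_derivative_within_subset[OF der]) auto
      then show "((\<lambda>t. H (z t)) has_vector_derivative gradient H (z t) \<bullet> F (z t)) (at t within {0..T})"
        by (rule C1_chain_rule[OF C1])
    qed
    then have "H (z T) - H (z 0) \<le> 0"
    proof (rule has_integral_le[OF _ has_integral_0])
      fix t
      \<comment> \<open>The nonnegative cutoff factor rescales the decay rate of \<open>H\<close>
        without changing its sign.\<close>
      have "gradient H (z t) \<bullet> F (z t) = - cutoff (z t) * (h (z t) \<bullet> h (z t) + l (z t) \<bullet> l (z t))"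
        unfolding F_def G_def inner_scaleR_right gradient_inner_rhs by (simp add: algebra_simps)
      also have "\<dots> \<le> 0" by (intro mult_nonpos_nonneg) (auto simp: cutoff_def)
      finally show "gradient H (z t) \<bullet> F (z t) \<le> 0" .
    qed
    then show ?thesis by (simp add: z0)
  qed
  then have FG: "F (z t) = G (z t)" if "t \<ge> 0" for t
    using that by (force simp: F_def cutoff_def max_def min_def)
  have "abs_cont_on {0..T} z" for T
    by (rule lipschitz_compose_abs_cont_on[OF abs_cont_on_ident, of _ _ _ "max 0 B"]) (use lip in auto)
  then have "trajectory f g z0 (\<lambda>t. - h (z t)) z"
    unfolding trajectory_def using z0 der FG by (auto simp: G_def intro!: AE_I2)
  then show ?thesis by (rule that)
qed

lemma value_function_eq: "value_function f g h l z0 = ennreal (H z0)"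
proof (rule antisym)
  obtain z where tr: "trajectory f g z0 (\<lambda>t. - h (z t)) z" using closed_loop_exists by blast
  show "value_function f g h l z0 \<le> ennreal (H z0)"
    unfolding value_function_def
    by (rule INF_lower2[OF closed_loop_admissible(1)[OF tr]]) (simp add: closed_loop_admissible(2)[OF tr])
  show "ennreal (H z0) \<le> value_function f g h l z0"
    unfolding value_function_def by (rule INF_greatest) (auto intro: admissible_cost_ge)
qed

text \<open>Admissibility and cost were established for every closed-loop solution, so possible
  non-uniqueness does no harm.\<close>

lemma optimal_feedback_output: "optimal_feedback f g h l (\<lambda>z. - h z)"
  unfolding optimal_feedback_def value_function_eq
  using closed_loop_exists closed_loop_admissible by metis

end

theorem theorem5:
  fixes f :: "real^'n \<Rightarrow> real^'n"
    and g :: "real^'n \<Rightarrow> real^'m^'n"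
    and h :: "real^'n \<Rightarrow> real^'m"
    and l :: "real^'n \<Rightarrow> real^'p"
    and H :: "real^'n \<Rightarrow> real"
  assumes "continuous_on UNIV f" and "continuous_on UNIV g" and "continuous_on UNIV h"
    and "f 0 = 0"
    and "solutions_exist f g"
    and "C1 H" and "\<forall>z. H z \<ge> 0"
    and "continuous_on UNIV l"
    and "\<forall>z. gradient H z \<bullet> f z = - (l z \<bullet> l z)"
    and "\<forall>z. transpose (g z) *v gradient H z = h z"
    and "filterlim H at_top at_infinity"
    and "H 0 = 0" and "\<forall>z. z \<noteq> 0 \<longrightarrow> H z > 0"
    and "\<forall>z. z \<noteq> 0 \<longrightarrow> l z \<bullet> l z + h z \<bullet> h z > 0"
  shows "(\<forall>z0. value_function f g h l z0 = ennreal (H z0)) \<and>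
    (\<forall>z. - (transpose (g z) *v gradient H z) = - h z) \<and>
    optimal_feedback f g h l (\<lambda>z. - (transpose (g z) *v gradient H z))"
proof -
  interpret lossless_system f g h l H
    by unfold_locales (use assms in auto)
  show ?thesis
    unfolding output_eq using value_function_eq optimal_feedback_output by blast
qed

end
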